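(* Let $r\ge 3$ and $n \ge 2(r^2-r+1)$ be integers, put $m = n-r$, and let $0<t_1<t_2<\cdots<t_n$ be integers. Let $A$ be the $m\times n$ matrix whose $j$-th column is $(1,t_j,t_j^2,\dots,t_j^{m-1})^T$. Then the toric ideal $I_A\subset\mathbb{C}[x_1,\dots,x_n]$ does not contain any complete intersection basis ideal; that is, for every set $B = \{v_1,\dots,v_r\}\subset\mathcal{L}_A$ of $r$ vectors linearly independent over $\mathbb{Q}$, the ideal $J_B$ is not a complete intersection.
   Context: For an integer $m\times n$ matrix $A$ of rank $m$, put $r = n-m$ and $\mathcal{L}_A = \{v\in\mathbb{Z}^n : A\cdot v = 0\}$, a lattice of rank $r$. The toric ideal $I_A\subset \mathbb{C}[x_1,\dots,x_n]$ is the ideal generated by all binomials $x^u - x^v$ with $u,v\in\mathbb{N}^n$ and $A\cdot u = A\cdot v$. For $v\in\mathbb{Z}^n$ write $v = v^+ - v^-$, where $v^+,v^-\in\mathbb{N}^n$ have disjoint supports (positive and negative parts). Let $B = \{v_1,\dots,v_r\}\subset\mathcal{L}_A$ be a set of $r$ vectors linearly independent over $\mathbb{Q}$. The basis ideal $J_B$ is the ideal of $\mathbb{C}[x_1,\dots,x_n]$ generated by the $r$ binomials $x^{v_j^+} - x^{v_j^-}$, $j=1,\dots,r$; it is contained in $I_A$. The ideal $J_B$ is a complete intersection if its height (codimension) equals $r$. *)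

theory Defs
  imports
    Complex_Main
    "HOL-Library.Poly_Mapping"
    "HOL-Library.Extended_Nat"
    "HOL-Algebra.Ideal"
    "Jordan_Normal_Form.Matrix_Kernel"
begin

text \<open>
  The polynomial ring \<open>\<complex>[x\<^sub>0, \<dots>, x\<^bsub>n-1\<^esub>]\<close>. Polynomials in countably many variables are finitely
  supported maps from exponents to coefficients; multiplication of \<open>poly_mapping\<close> is convolution.
  The carrier consists of the polynomials that involve only variables with index below \<open>n\<close>.
\<close>

type_synonym cpoly = "(nat \<Rightarrow>\<^sub>0 nat) \<Rightarrow>\<^sub>0 complex"

definition poly_ring :: "nat \<Rightarrow> cpoly ring" where
  "poly_ring n =
     \<lparr>carrier = {p. \<forall>e \<in> Poly_Mapping.keys p. Poly_Mapping.keys e \<subseteq> {..<n}},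
      mult = (*), one = 1, zero = 0, add = (+)\<rparr>"

definition var :: "nat \<Rightarrow> cpoly" where
  "var i = Poly_Mapping.single (Poly_Mapping.single i 1) 1"

definition monomial :: "nat vec \<Rightarrow> cpoly" where
  "monomial u = (\<Prod>i<dim_vec u. var i ^ (u $ i))"

definition pos_part :: "int vec \<Rightarrow> nat vec" where
  "pos_part v = map_vec (\<lambda>a. nat a) v"

definition neg_part :: "int vec \<Rightarrow> nat vec" where
  "neg_part v = map_vec (\<lambda>a. nat (- a)) v"

definition toric_ideal :: "int mat \<Rightarrow> cpoly set" where
  "toric_ideal A = genideal (poly_ring (dim_col A))
     {monomial u - monomial v | u v.
        u \<in> carrier_vec (dim_col A) \<and> v \<in> carrier_vec (dim_col A) \<and>
        A *\<^sub>v map_vec int u = A *\<^sub>v map_vec int v}"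

text \<open>
  For an integer matrix \<open>A\<close>, the set \<^term>\<open>mat_kernel A\<close> is the lattice of integer vectors
  annihilated by \<open>A\<close>.
\<close>

definition rat_lin_indpt :: "nat \<Rightarrow> int vec set \<Rightarrow> bool" where
  "rat_lin_indpt n B \<longleftrightarrow>
     \<not> LinearCombinations.module.lin_dep class_ring (module_vec TYPE(rat) n)
         (map_vec rat_of_int ` B)"

definition independent_lattice_vectors :: "int mat \<Rightarrow> nat \<Rightarrow> int vec set \<Rightarrow> bool" where
  "independent_lattice_vectors A r B \<longleftrightarrow>
     B \<subseteq> mat_kernel A \<and> finite B \<and> card B = r \<and> rat_lin_indpt (dim_col A) B"

definition basis_ideal :: "nat \<Rightarrow> int vec set \<Rightarrow> cpoly set" where
  "basis_ideal n B = genideal (poly_ring n)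
     ((\<lambda>v. monomial (pos_part v) - monomial (neg_part v)) ` B)"

text \<open>
  The height of a prime ideal \<open>P\<close> is the supremum of the lengths \<open>k\<close> of strictly increasing chains
  of prime ideals \<open>C 0 \<subset> \<dots> \<subset> C k = P\<close>; the height of an arbitrary ideal is the infimum of
  the heights of the primes containing it (infinity for the unit ideal).
\<close>

definition prime_height :: "('a, 'b) ring_scheme \<Rightarrow> 'a set \<Rightarrow> enat" where
  "prime_height R P = Sup {enat k | k. \<exists>C :: nat \<Rightarrow> 'a set.
     (\<forall>i\<le>k. primeideal (C i) R) \<and> (\<forall>i<k. C i \<subset> C (Suc i)) \<and> C k = P}"

definition ideal_height :: "('a, 'b) ring_scheme \<Rightarrow> 'a set \<Rightarrow> enat" where
  "ideal_height R I = Inf {prime_height R P | P. primeideal P R \<and> I \<subseteq> P}"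

text \<open>The number \<open>r\<close> is the number of binomials generating \<open>J\<close>.\<close>

definition complete_intersection :: "nat \<Rightarrow> nat \<Rightarrow> cpoly set \<Rightarrow> bool" where
  "complete_intersection n r J \<longleftrightarrow> ideal_height (poly_ring n) J = enat r"

lemma poly_ring_carrier_iff:
  "p \<in> carrier (poly_ring n) \<longleftrightarrow>
     (\<forall>e \<in> Poly_Mapping.keys p. Poly_Mapping.keys e \<subseteq> {..<n})"
  by (simp add: poly_ring_def)

lemma poly_ring_add_closed:
  assumes "p \<in> carrier (poly_ring n)" "q \<in> carrier (poly_ring n)"
  shows "p + q \<in> carrier (poly_ring n)"
  unfolding poly_ring_carrier_iff
proof
  fix e assume "e \<in> Poly_Mapping.keys (p + q)"
  then have "e \<in> Poly_Mapping.keys p \<or> e \<in> Poly_Mapping.keys q"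
    using Poly_Mapping.keys_add[of p q] by blast
  then show "Poly_Mapping.keys e \<subseteq> {..<n}"
    using assms unfolding poly_ring_carrier_iff by metis
qed

lemma poly_ring_mult_closed:
  assumes "p \<in> carrier (poly_ring n)" "q \<in> carrier (poly_ring n)"
  shows "p * q \<in> carrier (poly_ring n)"
  unfolding poly_ring_carrier_iff
proof
  fix e assume "e \<in> Poly_Mapping.keys (p * q)"
  then obtain a b where e: "e = a + b"
    and "a \<in> Poly_Mapping.keys p" "b \<in> Poly_Mapping.keys q"
    using keys_mult[of p q] by blast
  then have "Poly_Mapping.keys a \<subseteq> {..<n}" "Poly_Mapping.keys b \<subseteq> {..<n}"
    using assms unfolding poly_ring_carrier_iff by metis+
  then show "Poly_Mapping.keys e \<subseteq> {..<n}"
    unfolding e using Poly_Mapping.keys_add[of a b] by (meson Un_least order_trans)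
qed

lemma poly_ring_cring: "cring (poly_ring n)"
proof (rule cringI)
  show "abelian_group (poly_ring n)"
  proof (rule abelian_groupI)
    fix x assume x: "x \<in> carrier (poly_ring n)"
    then have "- x \<in> carrier (poly_ring n)"
      by (simp add: poly_ring_carrier_iff)
    then show "\<exists>y\<in>carrier (poly_ring n). y \<oplus>\<^bsub>poly_ring n\<^esub> x = \<zero>\<^bsub>poly_ring n\<^esub>"
      by (rule rev_bexI) (simp add: poly_ring_def)
  next
    fix x y assume "x \<in> carrier (poly_ring n)" "y \<in> carrier (poly_ring n)"
    then show "x \<oplus>\<^bsub>poly_ring n\<^esub> y \<in> carrier (poly_ring n)"
      using poly_ring_add_closed[of x n y] by (simp add: poly_ring_def)
  qed (simp_all add: poly_ring_def add_ac)
  show "comm_monoid (poly_ring n)"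
  proof (rule comm_monoidI)
    fix x y assume "x \<in> carrier (poly_ring n)" "y \<in> carrier (poly_ring n)"
    then show "x \<otimes>\<^bsub>poly_ring n\<^esub> y \<in> carrier (poly_ring n)"
      using poly_ring_mult_closed[of x n y] by (simp add: poly_ring_def)
  qed (simp_all add: poly_ring_def mult_ac)
qed (simp add: poly_ring_def distrib_right)

lemma monomial_in_poly_ring:
  assumes "u \<in> carrier_vec n"
  shows "monomial u \<in> carrier (poly_ring n)"
proof -
  have one: "1 \<in> carrier (poly_ring n)"
    by (simp add: poly_ring_carrier_iff)
  have pow: "p ^ k \<in> carrier (poly_ring n)" if "p \<in> carrier (poly_ring n)" for p k
    using that by (induction k) (simp_all add: one poly_ring_mult_closed)
  have "(\<Prod>i<k. var i ^ (u $ i)) \<in> carrier (poly_ring n)" if "k \<le> n" for k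
    using that
  proof (induction k)
    case (Suc k)
    then have "var k \<in> carrier (poly_ring n)"
      by (simp add: poly_ring_carrier_iff var_def)
    with Suc show ?case by (simp add: pow poly_ring_mult_closed)
  qed (simp add: one)
  then show ?thesis using assms by (simp add: monomial_def)
qed

lemma basis_ideal_subset_toric_ideal:
  assumes A: "A \<in> carrier_mat m n" and B: "B \<subseteq> mat_kernel A"
  shows "basis_ideal n B \<subseteq> toric_ideal A"
proof -
  let ?T = "{monomial u - monomial v | u v. u \<in> carrier_vec n \<and> v \<in> carrier_vec n \<and>
    A *\<^sub>v map_vec int u = A *\<^sub>v map_vec int v}"
  have "monomial (pos_part v) - monomial (neg_part v) \<in> ?T" if "v \<in> B" for v
  proof -
    have v: "v \<in> carrier_vec n" "A *\<^sub>v v = 0\<^sub>v m"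
      using that assms by (auto simp: mat_kernel_def)
    have parts: "pos_part v \<in> carrier_vec n" "neg_part v \<in> carrier_vec n"
      using v(1) by (simp_all add: pos_part_def neg_part_def)
    let ?p = "map_vec int (pos_part v)" and ?q = "map_vec int (neg_part v)"
    have q: "?q \<in> carrier_vec n"
      using parts(2) by simp
    have "?p = v + ?q"
      using v(1) by (intro eq_vecI) (auto simp: pos_part_def neg_part_def)
    then have "A *\<^sub>v ?p = A *\<^sub>v v + A *\<^sub>v ?q"
      using mult_add_distrib_mat_vec[OF A v(1) q] by simp
    also have "\<dots> = A *\<^sub>v ?q"
      unfolding v(2) by (rule left_zero_vec) (use A q in simp)
    finally show ?thesis using parts by blast
  qed
  then have "(\<lambda>v. monomial (pos_part v) - monomial (neg_part v)) ` B \<subseteq> ?T"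
    by (rule image_subsetI)
  moreover have "dim_col A = n" using A by simp
  ultimately show ?thesis
    unfolding basis_ideal_def toric_ideal_def genideal_def by (simp only:) blast
qed

end

theory Submission
  imports Defs
begin

text \<open>
  A nonzero vector of the lattice is orthogonal to all polynomials in the \<open>t\<^sub>j\<close> of degree below
  \<open>n - r\<close>, hence changes sign at least \<open>n - r\<close> times, and at most \<open>2(r - 1)\<close> of its \<open>n - 1\<close> pairs of
  neighbouring entries fail to have opposite signs. As \<open>n - 1 > 2r(r - 1)\<close>, there is a position \<open>k\<close>
  at which all \<open>r\<close> vectors change sign, so the basis ideal lies in the prime
  \<open>(x\<^sub>k, x\<^bsub>k+1\<^esub>)\<close>. This prime has height at most two: picking an element from
  each step of a chain of primes of length three below it, one obtains together with the other
  variables \<open>n + 1\<close> algebraically dependent polynomials, and the lexicographically lowest part of the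
  relation is a nonzero polynomial in the other variables that lies in \<open>(x\<^sub>k, x\<^bsub>k+1\<^esub>)\<close>.
\<close>

section \<open>Sign changes of lattice vectors\<close>

text \<open>Expand \<open>q\<close> in powers and exchange the two sums: every coefficient of
  \<open>q\<close> then multiplies one of the vanishing moments.\<close>

lemma sum_mult_poly_eq_0:
  fixes v t :: "nat \<Rightarrow> int"
  assumes "\<And>i. i < m \<Longrightarrow> (\<Sum>k<n. v k * t k ^ i) = 0" and "degree q < m"
  shows "(\<Sum>k<n. v k * poly q (t k)) = 0"
proof -
  have "(\<Sum>k<n. v k * poly q (t k)) = (\<Sum>k<n. \<Sum>i\<le>degree q. coeff q i * (v k * t k ^ i))"
    by (simp add: poly_altdef sum_distrib_left algebra_simps)
  also have "\<dots> = (\<Sum>i\<le>degree q. coeff q i * (\<Sum>k<n. v k * t k ^ i))"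
    by (subst sum.swap) (simp add: sum_distrib_left)
  also have "\<dots> = 0"
    using assms by (intro sum.neutral) auto
  finally show ?thesis .
qed

text \<open>
  The function \<open>s\<close> records the signs of \<open>v\<close>, the signs at the zeros of \<open>v\<close> being arbitrary. A polynomial
  changing sign exactly where \<open>s\<close> does pairs positively with \<open>v\<close>, so its degree is at least \<open>m\<close>.
\<close>

lemma sign_changes_ge:
  fixes v t s :: "nat \<Rightarrow> int"
  assumes t: "strict_mono_on {..<n} t"
    and v: "\<And>i. i < m \<Longrightarrow> (\<Sum>k<n. v k * t k ^ i) = 0"
    and s: "\<And>k. k < n \<Longrightarrow> s k = 1 \<or> s k = -1" "\<And>k. k < n \<Longrightarrow> v k * s k \<ge> 0"
    and p: "p < n" "v p \<noteq> 0"
  shows "m \<le> card {k. Suc k < n \<and> s (Suc k) \<noteq> s k}"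
proof (rule ccontr)
  define Ch where "Ch = {k. Suc k < n \<and> s (Suc k) \<noteq> s k}"
  \<comment> \<open>The factor for \<open>k\<close> is \<open>2 * x + 1 - 2 * t (Suc k)\<close>,
    with root \<open>t (Suc k) - 1/2\<close>. As \<open>t\<close> takes integer values, this lies
    strictly between \<open>t k\<close> and \<open>t (Suc k)\<close>; the doubling keeps the
    coefficients integral.\<close>
  define q where "q = (\<Prod>k\<in>Ch. [:1 - 2 * t (Suc k), 2:])"
  assume "\<not> ?thesis"
  moreover have fin: "finite Ch"
    unfolding Ch_def by (rule finite_subset[of _ "{..<n}"]) auto
  moreover have "degree q \<le> card Ch"
    using degree_prod_sum_le[OF fin, of "\<lambda>k. [:1 - 2 * t (Suc k), 2:]"]
    by (simp add: q_def)
  ultimately have "degree q < m" by (simp add: Ch_def)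
  then have sum0: "(\<Sum>k<n. v k * poly q (t k)) = 0"
    using v by (intro sum_mult_poly_eq_0) auto
  have sgn_q: "sgn (poly q (t k)) = (\<Prod>j\<in>Ch. if j < k then 1 else -1)" if k: "k < n" for k
  proof -
    have "sgn (poly [:1 - 2 * t (Suc j), 2:] (t k)) = (if j < k then 1 else -1)" if j: "j \<in> Ch" for j
    proof (cases "j < k")
      case True
      then have "t (Suc j) \<le> t k"
        using strict_mono_onD[OF t, of "Suc j" k] k by (cases "Suc j = k") auto
      with True show ?thesis by simp
    next
      case False
      then have "t k < t (Suc j)"
        using strict_mono_onD[OF t, of k "Suc j"] j by (auto simp: Ch_def)
      with False show ?thesis by simp
    qed
    moreover have "sgn (\<Prod>j\<in>Ch. g j) = (\<Prod>j\<in>Ch. sgn (g j))" for g :: "nat \<Rightarrow> int"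
      using fin by (induction rule: finite_induct) (auto simp: sgn_mult)
    ultimately show ?thesis
      unfolding q_def poly_prod by simp
  qed
  \<comment> \<open>Walking from \<open>0\<close> to \<open>k\<close>, the sign flips once for every
    element of \<open>Ch\<close> below \<open>k\<close>.\<close>
  have s_eq: "s k = s 0 * (\<Prod>j\<in>Ch. if j < k then -1 else 1)" if "k < n" for k
    using that
  proof (induction k)
    case (Suc k)
    have eq: "(\<Prod>j\<in>Ch. if j < Suc k then -1 else 1 :: int)
        = (\<Prod>j\<in>Ch. if j < k then -1 else 1) * (\<Prod>j\<in>Ch. if j = k then -1 else 1)"
      unfolding prod.distrib[symmetric] by (rule prod.cong) auto
    have "(\<Prod>j\<in>Ch. if j = k then -1 else 1 :: int) = (if k \<in> Ch then -1 else 1)"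
      using fin by (simp add: prod.delta)
    moreover have "s (Suc k) = s k * (if k \<in> Ch then -1 else 1)"
      using s(1)[of k] s(1)[of "Suc k"] Suc.prems by (auto simp: Ch_def)
    ultimately show ?case using Suc eq by simp
  qed simp
  \<comment> \<open>For each \<open>j\<close> in \<open>Ch\<close>, exactly one of the two sign
    factors is \<open>-1\<close>, so their product does not depend on \<open>k\<close>:
    \<open>s\<close> and \<open>q\<close> have the same sign pattern up to the global sign
    \<open>\<epsilon>\<close>.\<close>
  have const: "s k * sgn (poly q (t k)) = s 0 * (-1) ^ card Ch" if "k < n" for k
  proof -
    have "(\<Prod>j\<in>Ch. if j < k then -1 else 1) * (\<Prod>j\<in>Ch. if j < k then 1 else -1) = (\<Prod>j\<in>Ch. -1 :: int)"
      unfolding prod.distrib[symmetric] by (rule prod.cong) auto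
    then show ?thesis
      unfolding s_eq[OF that] sgn_q[OF that] by (simp add: mult.assoc)
  qed
  define \<epsilon> where "\<epsilon> = s 0 * (-1) ^ card Ch"
  have pm: "\<epsilon> = 1 \<or> \<epsilon> = -1"
    using s(1)[of 0] p by (cases "even (card Ch)") (auto simp: \<epsilon>_def)
  have signed: "v k * poly q (t k) * \<epsilon> = (v k * s k) * \<bar>poly q (t k)\<bar>" if "k < n" for k
    using const[OF that] s(1)[OF that] unfolding \<epsilon>_def[symmetric]
    by (auto simp: abs_if sgn_if split: if_splits)
  have nz: "poly q (t k) \<noteq> 0" if "k < n" for k
    using const[OF that] pm unfolding \<epsilon>_def[symmetric] by auto
  have "(\<Sum>k<n. v k * poly q (t k) * \<epsilon>) > 0"
  proof (rule sum_pos2[of _ p])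
    have "v p * s p > 0"
      using s(1)[of p] s(2)[of p] p by auto
    then show "0 < v p * poly q (t p) * \<epsilon>"
      using nz[of p] p by (simp add: signed)
  qed (use p s(2) in \<open>auto simp: signed\<close>)
  then show False
    using sum0 by (simp add: sum_distrib_right[symmetric])
qed

text \<open>Fill the zeros of \<open>v\<close> with neighbouring signs to get \<open>s\<close>. A
  pair fails to alternate if \<open>s\<close> does not change there or if its left entry is zero.
  Since \<open>s\<close> changes at least \<open>m\<close> times, each of these two cases occurs at
  most \<open>n - 1 - m\<close> times.\<close>

lemma card_nonalternating_le:
  fixes v t :: "nat \<Rightarrow> int"
  assumes t: "strict_mono_on {..<n} t"
    and v: "\<And>i. i < m \<Longrightarrow> (\<Sum>k<n. v k * t k ^ i) = 0"
    and nz: "\<exists>k<n. v k \<noteq> 0"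
  shows "card {k. Suc k < n \<and> v k * v (Suc k) \<ge> 0} \<le> 2 * (n - 1 - m)"
proof -
  define p where "p = (LEAST k. k < n \<and> v k \<noteq> 0)"
  have p: "p < n" "v p \<noteq> 0"
    using LeastI_ex[OF nz] by (auto simp: p_def)
  have least: "v k = 0" if "k < p" for k
    using not_less_Least[OF that[unfolded p_def]] that p(1) by auto
  \<comment> \<open>A zero inherits the sign on its left, and leading zeros take the sign of the
    first nonzero entry \<open>v p\<close>. So \<open>s\<close> changes only on arrival at a nonzero
    entry other than \<open>p\<close>.\<close>
  define s where "s = rec_nat (sgn (v p)) (\<lambda>k x. if v (Suc k) = 0 then x else sgn (v (Suc k)))"
  have s0: "s 0 = sgn (v p)" and sSuc: "s (Suc k) = (if v (Suc k) = 0 then s k else sgn (v (Suc k)))"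
    for k by (simp_all add: s_def)
  have s_pm: "s k = 1 \<or> s k = -1" for k
    by (induction k) (use p in \<open>auto simp: s0 sSuc sgn_if\<close>)
  have s_v: "s k = sgn (v k)" if "v k \<noteq> 0" for k
  proof (cases k)
    case 0
    then have "p = 0" using that least[of 0] by auto
    then show ?thesis using 0 by (simp add: s0)
  qed (use that in \<open>simp add: sSuc\<close>)
  have s_p: "s k = sgn (v p)" if "k \<le> p" for k
    using that
  proof (induction k)
    case (Suc k)
    then show ?case using least[of "Suc k"] by (cases "Suc k = p") (auto simp: sSuc)
  qed (simp add: s0)
  define Ch where "Ch = {k. Suc k < n \<and> s (Suc k) \<noteq> s k}"
  define Z where "Z = {k. k < n \<and> v k = 0}"
  have fin: "finite Ch" "finite Z"
    unfolding Ch_def Z_def by (auto intro: finite_subset[of _ "{..<n}"])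
  have m: "m \<le> card Ch"
    unfolding Ch_def
  proof (rule sign_changes_ge[OF t v _ _ p])
    show "0 \<le> v k * s k" for k
      using s_v[of k] by (cases "v k = 0") (auto simp: sgn_if)
  qed (use s_pm in auto)
  have Ch_sub: "Ch \<subseteq> {..<n - 1}"
    by (auto simp: Ch_def)
  \<comment> \<open>The arrival points of sign changes are nonzero entries, and \<open>p\<close> is
    one more nonzero entry; hence at most \<open>n - 1 - card Ch\<close> zeros remain.\<close>
  have "Suc k \<notin> Z \<and> Suc k \<noteq> p" if "k \<in> Ch" for k
    using that s_p[of k] s_p[of "Suc k"] by (auto simp: Ch_def Z_def sSuc)
  then have "Z \<subseteq> {..<n} - insert p (Suc ` Ch)"
    using p by (auto simp: Z_def)
  moreover have "card ({..<n} - insert p (Suc ` Ch)) = n - Suc (card Ch)"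
  proof -
    have "p \<notin> Suc ` Ch"
      using \<open>\<And>k. k \<in> Ch \<Longrightarrow> Suc k \<notin> Z \<and> Suc k \<noteq> p\<close> by auto
    then have "card (insert p (Suc ` Ch)) = Suc (card Ch)"
      using fin by (simp add: card_image)
    then show ?thesis
      using p fin by (subst card_Diff_subset) (auto simp: Ch_def)
  qed
  ultimately have Zle: "card Z \<le> n - Suc (card Ch)"
    by (metis card_mono finite_Diff finite_lessThan)
  \<comment> \<open>Only a zero at the left end of the pair has to be charged to \<open>Z\<close>:
    if \<open>v k\<close> is nonzero and \<open>v (Suc k) = 0\<close>, then \<open>s\<close> is
    inherited and does not change at \<open>k\<close>.\<close>
  have "{k. Suc k < n \<and> v k * v (Suc k) \<ge> 0} \<subseteq> ({..<n - 1} - Ch) \<union> Z"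
  proof
    fix k assume "k \<in> {k. Suc k < n \<and> v k * v (Suc k) \<ge> 0}"
    then have k: "Suc k < n" "v k * v (Suc k) \<ge> 0" by auto
    show "k \<in> ({..<n - 1} - Ch) \<union> Z"
    proof (cases "v k = 0")
      case False
      have "s (Suc k) = s k"
        using False k s_v[of k] by (auto simp: sSuc sgn_if zero_le_mult_iff)
      then show ?thesis using k by (auto simp: Ch_def)
    qed (use k in \<open>auto simp: Z_def\<close>)
  qed
  then have "card {k. Suc k < n \<and> v k * v (Suc k) \<ge> 0} \<le> card (({..<n - 1} - Ch) \<union> Z)"
    using fin by (intro card_mono) auto
  also have "\<dots> \<le> card ({..<n - 1} - Ch) + card Z"
    by (rule card_Un_le)
  also have "card ({..<n - 1} - Ch) = n - 1 - card Ch"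
    using Ch_sub fin by (simp add: card_Diff_subset)
  finally show ?thesis using Zle m by linarith
qed

section \<open>Algebraic dependence\<close>

text \<open>Gaussian elimination by induction on the equations \<open>J\<close>: an equation with a
  nonzero coefficient removes itself and one unknown, so unknowns stay in the majority.\<close>

lemma homogeneous_system_nontrivial_solution:
  fixes a :: "'i \<Rightarrow> 'j \<Rightarrow> 'k :: field"
  assumes "finite J" "finite I" "card J < card I"
  shows "\<exists>x. (\<exists>i\<in>I. x i \<noteq> 0) \<and> (\<forall>j\<in>J. (\<Sum>i\<in>I. a i j * x i) = 0)"
  using assms
proof (induction J arbitrary: I a rule: finite_induct)
  case empty
  then obtain i where "i \<in> I" by (cases "I = {}") auto
  then show ?case by (intro exI[of _ "\<lambda>_. 1"]) auto
next
  case (insert j J)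
  show ?case
  proof (cases "\<forall>i\<in>I. a i j = 0")
    case True
    obtain x where "\<exists>i\<in>I. x i \<noteq> 0" "\<forall>k\<in>J. (\<Sum>i\<in>I. a i k * x i) = 0"
      using insert.IH[of I a] insert.prems insert.hyps by auto
    with True show ?thesis by (intro exI[of _ x]) auto
  next
    case False
    then obtain l where l: "l \<in> I" "a l j \<noteq> 0" by auto
    \<comment> \<open>Coefficients after eliminating unknown \<open>l\<close> by means of equation
      \<open>j\<close>; in particular \<open>b i j = 0\<close>.\<close>
    define b where "b = (\<lambda>i k. a i k - a i j / a l j * a l k)"
    have "card J < card (I - {l})"
      using insert.prems insert.hyps l by simp
    then obtain x where x: "\<exists>i\<in>I - {l}. x i \<noteq> 0" "\<forall>k\<in>J. (\<Sum>i\<in>I - {l}. b i k * x i) = 0"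
      using insert.IH[of "I - {l}" b] insert.prems by blast
    \<comment> \<open>Back substitution: the value at \<open>l\<close> is the one forced by equation
      \<open>j\<close>.\<close>
    define y where "y = x(l := - (\<Sum>i\<in>I - {l}. a i j / a l j * x i))"
    have sum_y: "(\<Sum>i\<in>I. a i k * y i) = (\<Sum>i\<in>I - {l}. b i k * x i)" for k
    proof -
      have "(\<Sum>i\<in>I. a i k * y i) = a l k * y l + (\<Sum>i\<in>I - {l}. a i k * y i)"
        using insert.prems l by (simp add: sum.remove)
      also have "(\<Sum>i\<in>I - {l}. a i k * y i) = (\<Sum>i\<in>I - {l}. a i k * x i)"
        by (rule sum.cong) (auto simp: y_def)
      finally show ?thesis
        by (simp add: y_def b_def sum_distrib_left left_diff_distrib sum_subtractf algebra_simps)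
    qed
    have "(\<Sum>i\<in>I. a i j * y i) = 0"
      unfolding sum_y using l by (intro sum.neutral) (simp add: b_def)
    moreover have "(\<Sum>i\<in>I. a i k * y i) = 0" if "k \<in> J" for k
      unfolding sum_y using x(2) that by blast
    moreover have "\<exists>i\<in>I. y i \<noteq> 0"
      using x(1) by (auto simp: y_def)
    ultimately show ?thesis by (intro exI[of _ y]) auto
  qed
qed

text \<open>Bounding each exponent separately, not the total degree, gives a box with at most
  \<open>(d + 1) ^ n\<close> points, and the bounds still add up under multiplication.\<close>

definition exponents_le :: "nat \<Rightarrow> nat \<Rightarrow> (nat \<Rightarrow>\<^sub>0 nat) set" where
  "exponents_le n d = {e. Poly_Mapping.keys e \<subseteq> {..<n} \<and> (\<forall>l. Poly_Mapping.lookup e l \<le> d)}"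

lemma finite_exponents_le: "finite (exponents_le n d)"
  and card_exponents_le: "card (exponents_le n d) \<le> (d + 1) ^ n"
proof -
  let ?f = "\<lambda>e. restrict (Poly_Mapping.lookup e) {..<n}" and ?T = "{..<n} \<rightarrow>\<^sub>E {..d}"
  have inj: "inj_on ?f (exponents_le n d)"
  proof (rule inj_onI, rule poly_mapping_eqI)
    fix e e' l
    assume e: "e \<in> exponents_le n d" "e' \<in> exponents_le n d" and eq: "?f e = ?f e'"
    show "Poly_Mapping.lookup e l = Poly_Mapping.lookup e' l"
    proof (cases "l < n")
      case True
      then show ?thesis using fun_cong[OF eq, of l] by simp
    next
      case False
      then have "l \<notin> Poly_Mapping.keys e" "l \<notin> Poly_Mapping.keys e'"
        using e by (auto simp: exponents_le_def)
      then show ?thesis by (simp add: not_in_keys_iff_lookup_eq_zero)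
    qed
  qed
  have sub: "?f ` exponents_le n d \<subseteq> ?T"
    by (intro image_subsetI) (simp add: exponents_le_def restrict_PiE_iff)
  have fin: "finite ?T" by (simp add: finite_PiE)
  show "finite (exponents_le n d)"
    using inj sub fin by (meson finite_imageD finite_subset)
  have "card (exponents_le n d) \<le> card ?T"
    using card_inj_on_le[OF inj sub fin] .
  then show "card (exponents_le n d) \<le> (d + 1) ^ n"
    by (simp add: card_PiE)
qed

lemma exponents_le_add:
  assumes "a \<in> exponents_le n d" "b \<in> exponents_le n d'"
  shows "a + b \<in> exponents_le n (d + d')"
  using assms Poly_Mapping.keys_add[of a b]
  by (auto simp: exponents_le_def lookup_add add_mono)

lemma keys_mult_exponents_le:
  assumes "Poly_Mapping.keys p \<subseteq> exponents_le n d" "Poly_Mapping.keys q \<subseteq> exponents_le n d'"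
  shows "Poly_Mapping.keys (p * q :: cpoly) \<subseteq> exponents_le n (d + d')"
  using assms keys_mult[of p q] exponents_le_add by fastforce

lemma keys_one_exponents_le: "Poly_Mapping.keys (1 :: cpoly) \<subseteq> exponents_le n 0"
  by (auto simp: exponents_le_def)

lemma keys_power_exponents_le:
  assumes "Poly_Mapping.keys (p :: cpoly) \<subseteq> exponents_le n d"
  shows "Poly_Mapping.keys (p ^ k) \<subseteq> exponents_le n (k * d)"
proof (induction k)
  case (Suc k)
  then show ?case using keys_mult_exponents_le[OF assms Suc] by simp
qed (use keys_one_exponents_le in simp)

lemma keys_prod_exponents_le:
  assumes "finite S" "\<And>l. l \<in> S \<Longrightarrow> Poly_Mapping.keys (p l :: cpoly) \<subseteq> exponents_le n (d l)"
  shows "Poly_Mapping.keys (prod p S) \<subseteq> exponents_le n (sum d S)"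
  using assms
proof (induction rule: finite_induct)
  case (insert l S)
  then show ?case
    using keys_mult_exponents_le[of "p l" n "d l" "prod p S" "sum d S"] by simp
qed (use keys_one_exponents_le in simp)

lemma exponents_le_mono: "d \<le> d' \<Longrightarrow> exponents_le n d \<subseteq> exponents_le n d'"
  by (auto simp: exponents_le_def intro: order_trans)

lemma poly_ring_keys_bounded:
  assumes "p \<in> carrier (poly_ring n)"
  shows "\<exists>d. Poly_Mapping.keys p \<subseteq> exponents_le n d"
proof -
  let ?S = "\<Union>e\<in>Poly_Mapping.keys p. Poly_Mapping.range e"
  have fin: "finite ?S" by auto
  have "Poly_Mapping.lookup e l \<le> Max (insert 0 ?S)" if "e \<in> Poly_Mapping.keys p" for e l
  proof (cases "l \<in> Poly_Mapping.keys e")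
    case True
    then have "Poly_Mapping.lookup e l \<in> insert 0 ?S"
      using that by (intro insertI2 UN_I) auto
    then show ?thesis using fin by (intro Max_ge) auto
  qed (simp add: not_in_keys_iff_lookup_eq_zero)
  then show ?thesis
    using assms unfolding poly_ring_carrier_iff exponents_le_def by blast
qed

text \<open>
  Among the products of powers of the \<open>f l\<close> with exponents at most \<open>N\<close> there are \<open>(N + 1) ^ (n + 1)\<close>
  candidates, living in a space of dimension \<open>O(N ^ n)\<close>.
\<close>

lemma algebraically_dependent:
  fixes f :: "nat \<Rightarrow> cpoly"
  assumes f: "\<And>l. l \<le> n \<Longrightarrow> f l \<in> carrier (poly_ring n)"
  shows "\<exists>K c. finite K \<and> K \<noteq> {} \<and> K \<subseteq> {..n} \<rightarrow>\<^sub>E UNIV \<and> (\<forall>e\<in>K. c e \<noteq> 0) \<and>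
    (\<Sum>e\<in>K. Poly_Mapping.single 0 (c e) * (\<Prod>l\<le>n. f l ^ e l)) = 0"
proof -
  obtain D where D: "\<And>l. l \<le> n \<Longrightarrow> Poly_Mapping.keys (f l) \<subseteq> exponents_le n (D l)"
    using poly_ring_keys_bounded[OF f] by metis
  \<comment> \<open>These values make the count work:
    \<open>N * sum D {..n} + 1 \<le> b * (N + 1)\<close>, so the number of equations is at most
    \<open>b ^ n * (N + 1) ^ n = N * (N + 1) ^ n\<close>, which is below the
    \<open>(N + 1) ^ (n + 1)\<close> unknowns.\<close>
  define b where "b = Suc (sum D {..n})"
  define N where "N = b ^ n"
  let ?I = "{..n} \<rightarrow>\<^sub>E {..N}" and ?J = "exponents_le n (N * sum D {..n})"
  have keys: "Poly_Mapping.keys (\<Prod>l\<le>n. f l ^ e l) \<subseteq> ?J" if "e \<in> ?I" for e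
  proof -
    have "Poly_Mapping.keys (\<Prod>l\<le>n. f l ^ e l) \<subseteq> exponents_le n (\<Sum>l\<le>n. e l * D l)"
      using D by (intro keys_prod_exponents_le keys_power_exponents_le) auto
    also have "\<dots> \<subseteq> ?J"
      using that by (intro exponents_le_mono) (auto simp: sum_distrib_left intro!: sum_mono)
    finally show ?thesis .
  qed
  have "card ?J \<le> (N * sum D {..n} + 1) ^ n"
    by (rule card_exponents_le)
  also have "\<dots> \<le> (b * (N + 1)) ^ n"
    by (intro power_mono) (auto simp: b_def)
  also have "\<dots> = N * (N + 1) ^ n"
    by (simp only: N_def power_mult_distrib)
  also have "\<dots> < card ?I"
    by (simp add: card_PiE)
  finally have "card ?J < card ?I" .
  from homogeneous_system_nontrivial_solution[OF finite_exponents_le _ this,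
      of "\<lambda>e. Poly_Mapping.lookup (\<Prod>l\<le>n. f l ^ e l)"]
  obtain x where x: "\<exists>e\<in>?I. x e \<noteq> 0"
    "\<forall>k\<in>?J. (\<Sum>e\<in>?I. Poly_Mapping.lookup (\<Prod>l\<le>n. f l ^ e l) k * x e) = 0"
    by (auto simp: finite_PiE)
  \<comment> \<open>Passing to the support makes all coefficients nonzero, a property inherited by
    every subset of \<open>K\<close>.\<close>
  define K where "K = {e \<in> ?I. x e \<noteq> 0}"
  have lookup_scale: "Poly_Mapping.lookup (Poly_Mapping.single 0 c * p) k = c * Poly_Mapping.lookup p k"
    for c k and p :: cpoly
    by (simp add: mult_map_scale_conv_mult[symmetric] Poly_Mapping.map.rep_eq when_def)
  have "(\<Sum>e\<in>K. Poly_Mapping.single 0 (x e) * (\<Prod>l\<le>n. f l ^ e l)) = 0"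
  proof (rule poly_mapping_eqI)
    fix k
    have "Poly_Mapping.lookup (\<Sum>e\<in>K. Poly_Mapping.single 0 (x e) * (\<Prod>l\<le>n. f l ^ e l)) k
        = (\<Sum>e\<in>K. Poly_Mapping.lookup (\<Prod>l\<le>n. f l ^ e l) k * x e)"
      by (simp add: lookup_sum lookup_scale mult.commute)
    also have "\<dots> = (\<Sum>e\<in>?I. Poly_Mapping.lookup (\<Prod>l\<le>n. f l ^ e l) k * x e)"
      by (rule sum.mono_neutral_left) (auto simp: K_def finite_PiE)
    also have "\<dots> = 0"
    proof (cases "k \<in> ?J")
      case False
      then have "Poly_Mapping.lookup (\<Prod>l\<le>n. f l ^ e l) k = 0" if "e \<in> ?I" for e
        using contra_subsetD[OF keys[OF that] False] by (simp add: not_in_keys_iff_lookup_eq_zero)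
      then show ?thesis by (intro sum.neutral) simp
    qed (use x in blast)
    finally show "Poly_Mapping.lookup (\<Sum>e\<in>K. Poly_Mapping.single 0 (x e) * (\<Prod>l\<le>n. f l ^ e l)) k
        = Poly_Mapping.lookup 0 k" by simp
  qed
  moreover have "finite K" "K \<noteq> {}" "K \<subseteq> {..n} \<rightarrow>\<^sub>E UNIV" "\<forall>e\<in>K. x e \<noteq> 0"
    using x(1) by (auto simp: K_def finite_PiE)
  ultimately show ?thesis by (intro exI[of _ K] exI[of _ x] conjI)
qed

section \<open>Prime ideals of the polynomial ring\<close>

lemma poly_ring_simps [simp]:
  "\<zero>\<^bsub>poly_ring n\<^esub> = 0" "\<one>\<^bsub>poly_ring n\<^esub> = 1"
  "x \<oplus>\<^bsub>poly_ring n\<^esub> y = x + y" "x \<otimes>\<^bsub>poly_ring n\<^esub> y = x * y"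
  by (simp_all add: poly_ring_def)

lemma poly_ring_one_closed: "1 \<in> carrier (poly_ring n)"
  by (simp add: poly_ring_carrier_iff)

lemma poly_ring_uminus_closed: "p \<in> carrier (poly_ring n) \<Longrightarrow> - p \<in> carrier (poly_ring n)"
  by (simp add: poly_ring_carrier_iff)

lemma poly_ring_power_closed: "p \<in> carrier (poly_ring n) \<Longrightarrow> p ^ k \<in> carrier (poly_ring n)"
  by (induction k) (simp_all add: poly_ring_one_closed poly_ring_mult_closed)

lemma poly_ring_sum_closed:
  "(\<And>x. x \<in> S \<Longrightarrow> f x \<in> carrier (poly_ring n)) \<Longrightarrow> sum f S \<in> carrier (poly_ring n)"
  by (induction S rule: infinite_finite_induct)
    (auto simp: poly_ring_add_closed poly_ring_carrier_iff[of 0])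

lemma poly_ring_prod_closed:
  "(\<And>x. x \<in> S \<Longrightarrow> f x \<in> carrier (poly_ring n)) \<Longrightarrow> prod f S \<in> carrier (poly_ring n)"
  by (induction S rule: infinite_finite_induct)
    (auto simp: poly_ring_mult_closed poly_ring_one_closed)

lemma poly_ring_const_closed: "Poly_Mapping.single 0 c \<in> carrier (poly_ring n)"
  by (auto simp: poly_ring_carrier_iff)

lemma poly_ring_var_closed: "i < n \<Longrightarrow> var i \<in> carrier (poly_ring n)"
  by (simp add: poly_ring_carrier_iff var_def)

lemma prod_var_power:
  "finite S \<Longrightarrow> (\<Prod>l\<in>S. var l ^ e l) = Poly_Mapping.single (\<Sum>l\<in>S. Poly_Mapping.single l (e l)) 1"
proof (induction rule: finite_induct)
  case (insert l S)
  have "var l ^ k = Poly_Mapping.single (Poly_Mapping.single l k) 1" for k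
    by (induction k) (simp_all add: var_def mult_single single_add[symmetric])
  with insert show ?case by (simp add: mult_single)
qed simp

lemma lookup_sum_single:
  "finite S \<Longrightarrow> Poly_Mapping.lookup (\<Sum>l\<in>S. Poly_Mapping.single l (e l :: nat)) k
    = (if k \<in> S then e k else 0)"
  by (simp add: lookup_sum lookup_single when_def)

text \<open>The ideal generated by the variables with indices \<open>i\<close> and \<open>j\<close>.\<close>

definition two_var_ideal :: "nat \<Rightarrow> nat \<Rightarrow> nat \<Rightarrow> cpoly set" where
  "two_var_ideal n i j = {p \<in> carrier (poly_ring n).
     \<forall>e\<in>Poly_Mapping.keys p. Poly_Mapping.lookup e i \<noteq> 0 \<or> Poly_Mapping.lookup e j \<noteq> 0}"

lemma ideal_two_var_ideal: "ideal (two_var_ideal n i j) (poly_ring n)"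
proof -
  interpret R: cring "poly_ring n" by (rule poly_ring_cring)
  let ?P = "two_var_ideal n i j"
  have add: "p + q \<in> ?P" if "p \<in> ?P" "q \<in> ?P" for p q
    using that keys_add[of p q] poly_ring_add_closed[of p n q] unfolding two_var_ideal_def by blast
  have mult: "x * p \<in> ?P" if p: "p \<in> ?P" and x: "x \<in> carrier (poly_ring n)" for x p
  proof -
    have "Poly_Mapping.lookup e i \<noteq> 0 \<or> Poly_Mapping.lookup e j \<noteq> 0"
      if e: "e \<in> Poly_Mapping.keys (x * p)" for e
    proof -
      obtain a b where "e = a + b" "b \<in> Poly_Mapping.keys p"
        using e keys_mult[of x p] by blast
      then show ?thesis using p by (auto simp: two_var_ideal_def lookup_add)
    qed
    then show ?thesis
      using poly_ring_mult_closed[OF x, of p] p by (auto simp: two_var_ideal_def)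
  qed
  show ?thesis
  proof (rule idealI)
    show "subgroup ?P (add_monoid (poly_ring n))"
    proof (rule R.add.subgroupI)
      fix p assume p: "p \<in> ?P"
      then have "p \<in> carrier (poly_ring n)" by (simp add: two_var_ideal_def)
      then have "\<ominus>\<^bsub>poly_ring n\<^esub> p = - p"
        by (intro R.minus_equality) (auto simp: poly_ring_uminus_closed)
      then show "\<ominus>\<^bsub>poly_ring n\<^esub> p \<in> ?P"
        using p poly_ring_uminus_closed[of p n]
        by (auto simp: two_var_ideal_def)
    next
      have "0 \<in> ?P" using R.zero_closed by (simp add: two_var_ideal_def)
      then show "?P \<noteq> {}" by blast
    next
      show "?P \<subseteq> carrier (poly_ring n)" by (auto simp: two_var_ideal_def)
    next
      fix p q assume "p \<in> ?P" "q \<in> ?P"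
      then show "p \<oplus>\<^bsub>poly_ring n\<^esub> q \<in> ?P" unfolding poly_ring_simps by (rule add)
    qed
  next
    fix p x assume "p \<in> ?P" "x \<in> carrier (poly_ring n)"
    then have "x * p \<in> ?P" by (rule mult)
    then show "x \<otimes>\<^bsub>poly_ring n\<^esub> p \<in> ?P" "p \<otimes>\<^bsub>poly_ring n\<^esub> x \<in> ?P"
      by (simp_all add: mult.commute)
  qed (rule R.ring_axioms)
qed

text \<open>Modulo the ideal, each polynomial equals its \<open>part\<close> free of the variables
  \<open>i\<close> and \<open>j\<close>. If \<open>a * b\<close> is in the ideal, so is
  \<open>part a * part b\<close>; but this product is again free of both variables, hence zero, and
  one of the parts vanishes because polynomials form a domain.\<close>

lemma primeideal_two_var_ideal: "primeideal (two_var_ideal n i j) (poly_ring n)"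
proof (rule primeidealI[OF ideal_two_var_ideal poly_ring_cring])
  let ?P = "two_var_ideal n i j"
  interpret P: ideal ?P "poly_ring n" by (rule ideal_two_var_ideal)
  show "carrier (poly_ring n) \<noteq> ?P"
  proof
    assume "carrier (poly_ring n) = ?P"
    then have "1 \<in> ?P" using poly_ring_one_closed[of n] by simp
    then have "\<forall>e\<in>Poly_Mapping.keys (1 :: cpoly). Poly_Mapping.lookup e i \<noteq> 0 \<or> Poly_Mapping.lookup e j \<noteq> 0"
      unfolding two_var_ideal_def by blast
    then show False by simp
  qed
  let ?avoid = "\<lambda>e. Poly_Mapping.lookup e i = (0 :: nat) \<and> Poly_Mapping.lookup e j = (0 :: nat)"
  define part :: "cpoly \<Rightarrow> cpoly" where "part = Poly_Mapping.mapp (\<lambda>e c. c when ?avoid e)"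
  have lookup_part: "Poly_Mapping.lookup (part p) e = (Poly_Mapping.lookup p e when ?avoid e)" for p e
    by (auto simp: part_def lookup_mapp when_def in_keys_iff)
  have keys_part: "Poly_Mapping.keys (part p) = {e \<in> Poly_Mapping.keys p. ?avoid e}" for p
    by (auto simp: in_keys_iff lookup_part)
  have part_closed: "part p \<in> carrier (poly_ring n)" if "p \<in> carrier (poly_ring n)" for p
    using that by (auto simp: poly_ring_carrier_iff keys_part)
  have rest: "p - part p \<in> ?P" if p: "p \<in> carrier (poly_ring n)" for p
  proof -
    have "Poly_Mapping.keys (p - part p) = {e \<in> Poly_Mapping.keys p. \<not> ?avoid e}"
      by (auto simp: in_keys_iff lookup_minus lookup_part when_def split: if_splits)
    then show ?thesis using p by (auto simp: two_var_ideal_def poly_ring_carrier_iff)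
  qed
  fix a b
  assume a: "a \<in> carrier (poly_ring n)" and b: "b \<in> carrier (poly_ring n)"
    and ab: "a \<otimes>\<^bsub>poly_ring n\<^esub> b \<in> ?P"
  have mem: "(- a) * (b - part b) \<in> ?P" "(a - part a) * (- part b) \<in> ?P"
    using P.I_l_closed[OF rest[OF b], of "- a"] P.I_r_closed[OF rest[OF a], of "- part b"] a b
    by (simp_all add: part_closed poly_ring_uminus_closed)
  note add_closed = additive_subgroup.a_closed[OF P.is_additive_subgroup]
  have "(- a) * (b - part b) + (a - part a) * (- part b) + a * b \<in> ?P"
    using add_closed[OF add_closed[OF mem] ab] by (simp only: poly_ring_simps)
  moreover have "(- a) * (b - part b) + (a - part a) * (- part b) + a * b = part a * part b"
    by (simp add: algebra_simps)
  ultimately have P: "part a * part b \<in> ?P" by simp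
  have "Poly_Mapping.keys (part a * part b) = {}"
  proof (rule ccontr)
    assume "Poly_Mapping.keys (part a * part b) \<noteq> {}"
    then obtain e where e: "e \<in> Poly_Mapping.keys (part a * part b)" by blast
    then obtain u w where "e = u + w" "u \<in> Poly_Mapping.keys (part a)" "w \<in> Poly_Mapping.keys (part b)"
      using keys_mult[of "part a" "part b"] by blast
    then have "?avoid e" by (auto simp: keys_part lookup_add)
    then show False using P e unfolding two_var_ideal_def by blast
  qed
  then have "part a * part b = 0"
    by (simp only: keys_eq_empty)
  then have "part a = 0 \<or> part b = 0" by (simp only: mult_eq_0_iff)
  then show "a \<in> ?P \<or> b \<in> ?P" using rest[OF a] rest[OF b] by auto
qed

text \<open>
  Dividing a relation by the lowest power of \<open>a\<close> occurring in it and reducing modulo \<open>a\<close> moves it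
  from one member of a chain of primes to the next one.
\<close>

lemma primeideal_lowest_terms:
  assumes C: "primeideal C (poly_ring n)" and C': "ideal C' (poly_ring n)" "C \<subseteq> C'"
    and a: "a \<in> C'" "a \<notin> C"
    and K: "finite K" "K \<noteq> {}"
    and g: "\<And>e. e \<in> K \<Longrightarrow> g e \<in> carrier (poly_ring n)"
    and sum: "(\<Sum>e\<in>K. g e * a ^ d e) \<in> C"
  shows "\<exists>K'\<subseteq>K. K' \<noteq> {} \<and> (\<forall>e\<in>K'. \<forall>e'\<in>K'. d e = d e') \<and> (\<Sum>e\<in>K'. g e) \<in> C'"
proof -
  interpret C: primeideal C "poly_ring n" by (rule C)
  interpret C': ideal C' "poly_ring n" by (rule C'(1))
  have carr: "a \<in> carrier (poly_ring n)" using a(1) by (rule C'.Icarr)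
  define \<mu> where "\<mu> = Min (d ` K)"
  define K' where "K' = {e \<in> K. d e = \<mu>}"
  have "\<mu> \<in> d ` K" unfolding \<mu>_def using K by (intro Min_in) auto
  then have K'_ne: "K' \<noteq> {}" by (auto simp: K'_def)
  have \<mu>_le: "\<mu> \<le> d e" if "e \<in> K" for e
    unfolding \<mu>_def using K that by (intro Min_le) auto
  \<comment> \<open>\<open>T\<close> is the relation divided by \<open>a ^ \<mu>\<close>. As no
    power of \<open>a\<close> lies in the prime \<open>C\<close>, \<open>T\<close> itself lies in
    \<open>C\<close>.\<close>
  define T where "T = (\<Sum>e\<in>K. g e * a ^ (d e - \<mu>))"
  have T_carr: "T \<in> carrier (poly_ring n)"
    unfolding T_def using g carr
    by (intro poly_ring_sum_closed poly_ring_mult_closed poly_ring_power_closed) auto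
  have "(\<Sum>e\<in>K. g e * a ^ d e) = a ^ \<mu> * T"
    unfolding T_def sum_distrib_left
  proof (rule sum.cong[OF refl])
    fix e assume "e \<in> K"
    then have "a ^ d e = a ^ \<mu> * a ^ (d e - \<mu>)"
      using \<mu>_le by (simp add: power_add[symmetric])
    then show "g e * a ^ d e = a ^ \<mu> * (g e * a ^ (d e - \<mu>))"
      by (simp add: algebra_simps)
  qed
  then have "a ^ \<mu> * T \<in> C" using sum by simp
  moreover have "a ^ k \<notin> C" for k
  proof (induction k)
    case 0
    have "1 \<notin> C"
      using C.one_imp_carrier C.I_notcarr by auto
    then show ?case by simp
  next
    case (Suc k)
    then show ?case
      using C.I_prime[of a "a ^ k"] a(2) carr by (auto simp: poly_ring_power_closed)
  qed
  ultimately have T: "T \<in> C'"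
    using C.I_prime[of "a ^ \<mu>" T] T_carr carr C'(2) by (auto simp: poly_ring_power_closed)
  \<comment> \<open>Outside \<open>K'\<close> the exponent \<open>d e\<close> exceeds
    \<open>\<mu>\<close>, so these terms of \<open>T\<close> still contain a factor
    \<open>a\<close>; they add up to \<open>S * a\<close>, which lies in \<open>C'\<close>.\<close>
  define S where "S = (\<Sum>e\<in>K - K'. g e * a ^ (d e - Suc \<mu>))"
  have S_carr: "S \<in> carrier (poly_ring n)"
    unfolding S_def using g carr
    by (intro poly_ring_sum_closed poly_ring_mult_closed poly_ring_power_closed) auto
  have "T = (\<Sum>e\<in>K - K'. g e * a ^ (d e - \<mu>)) + (\<Sum>e\<in>K'. g e * a ^ (d e - \<mu>))"
    unfolding T_def using K by (intro sum.subset_diff) (auto simp: K'_def)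
  also have "(\<Sum>e\<in>K'. g e * a ^ (d e - \<mu>)) = (\<Sum>e\<in>K'. g e)"
    by (rule sum.cong) (auto simp: K'_def)
  also have "(\<Sum>e\<in>K - K'. g e * a ^ (d e - \<mu>)) = S * a"
    unfolding S_def sum_distrib_right
  proof (rule sum.cong[OF refl])
    fix e assume e: "e \<in> K - K'"
    then have "d e - \<mu> = Suc (d e - Suc \<mu>)"
      using \<mu>_le[of e] by (auto simp: K'_def)
    then show "g e * a ^ (d e - \<mu>) = g e * a ^ (d e - Suc \<mu>) * a"
      by (simp add: algebra_simps)
  qed
  finally have "(\<Sum>e\<in>K'. g e) = T + (- S) * a" by simp
  moreover have "T + (- S) * a \<in> C'"
    using C'.a_closed[OF T C'.I_l_closed[OF a(1) poly_ring_uminus_closed[OF S_carr]]]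
    by (simp only: poly_ring_simps)
  ultimately have "(\<Sum>e\<in>K'. g e) \<in> C'" by simp
  then show ?thesis
    using K'_ne by (intro exI[of _ K']) (auto simp: K'_def)
qed

text \<open>Three applications of \<open>primeideal_lowest_terms\<close> carry an algebraic relation
  from \<open>C0\<close> up to the top ideal. Each strips one of \<open>a1\<close>,
  \<open>a2\<close>, \<open>a3\<close> and makes its exponent constant on the surviving terms, so
  what is left is a nonzero polynomial without the variables \<open>i\<close> and
  \<open>j\<close>.\<close>

lemma no_prime_chain_two_var_ideal:
  assumes C: "primeideal C0 (poly_ring n)" "primeideal C1 (poly_ring n)" "primeideal C2 (poly_ring n)"
    and chain: "C0 \<subset> C1" "C1 \<subset> C2" "C2 \<subset> two_var_ideal n i j"
    and ij: "i < n" "j < n" "i \<noteq> j"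
  shows False
proof -
  let ?P = "two_var_ideal n i j"
  have ideals: "ideal C1 (poly_ring n)" "ideal C2 (poly_ring n)" "ideal ?P (poly_ring n)"
    using C by (simp_all add: primeideal.axioms(1) ideal_two_var_ideal)
  obtain a1 a2 a3 where a: "a1 \<in> C1" "a1 \<notin> C0" "a2 \<in> C2" "a2 \<notin> C1" "a3 \<in> ?P" "a3 \<notin> C2"
    using chain by blast
  have carr: "a1 \<in> carrier (poly_ring n)" "a2 \<in> carrier (poly_ring n)" "a3 \<in> carrier (poly_ring n)"
    using a ideals by (meson ideal.Icarr)+
  \<comment> \<open>\<open>a1\<close> and \<open>a2\<close> replace the variables \<open>i\<close>
    and \<open>j\<close>, and \<open>a3\<close> takes the additional index \<open>n\<close>: these
    are \<open>n + 1\<close> polynomials in \<open>n\<close> variables.\<close>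
  define f where "f = (\<lambda>l. if l = i then a1 else if l = j then a2 else if l = n then a3 else var l)"
  have "f l \<in> carrier (poly_ring n)" if "l \<le> n" for l
    using that carr by (auto simp: f_def poly_ring_var_closed)
  with algebraically_dependent[of n f]
  obtain K c where K: "finite K" "K \<noteq> {}" "K \<subseteq> {..n} \<rightarrow>\<^sub>E UNIV" and c: "\<forall>e\<in>K. c e \<noteq> 0"
    and rel: "(\<Sum>e\<in>K. Poly_Mapping.single 0 (c e) * (\<Prod>l\<le>n. f l ^ e l)) = 0"
    by blast
  define S where "S = {..<n} - {i, j}"
  define h where "h = (\<lambda>e. Poly_Mapping.single 0 (c e) * (\<Prod>l\<in>S. var l ^ e l))"
  have h_carr: "h e \<in> carrier (poly_ring n)" for e
    unfolding h_def by (intro poly_ring_mult_closed poly_ring_const_closed poly_ring_prod_closed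
        poly_ring_power_closed poly_ring_var_closed) (auto simp: S_def)
  have prod_eq: "Poly_Mapping.single 0 (c e) * (\<Prod>l\<le>n. f l ^ e l)
      = h e * a3 ^ e n * a2 ^ e j * a1 ^ e i" for e
  proof -
    have "{..n} = insert i (insert j (insert n S))" using ij by (auto simp: S_def)
    moreover have "(\<Prod>l\<in>S. f l ^ e l) = (\<Prod>l\<in>S. var l ^ e l)"
      by (rule prod.cong) (auto simp: S_def f_def)
    moreover have "i \<notin> insert j (insert n S)" "j \<notin> insert n S" "n \<notin> S" "finite S"
      using ij by (auto simp: S_def)
    ultimately show ?thesis
      using ij by (simp add: h_def f_def algebra_simps)
  qed
  have "(\<Sum>e\<in>K. h e * a3 ^ e n * a2 ^ e j * a1 ^ e i) = 0"
    using rel by (simp add: prod_eq)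
  moreover have "0 \<in> C0"
    using additive_subgroup.zero_closed[OF ideal.axioms(1)[OF primeideal.axioms(1)[OF C(1)]]] by simp
  ultimately have "(\<Sum>e\<in>K. h e * a3 ^ e n * a2 ^ e j * a1 ^ e i) \<in> C0" by simp
  from primeideal_lowest_terms[OF C(1) ideals(1) _ a(1,2) K(1,2) _ this]
  obtain K1 where K1: "K1 \<subseteq> K" "K1 \<noteq> {}" "\<forall>e\<in>K1. \<forall>e'\<in>K1. e i = e' i"
    "(\<Sum>e\<in>K1. h e * a3 ^ e n * a2 ^ e j) \<in> C1"
    using chain by (auto simp: poly_ring_mult_closed poly_ring_power_closed h_carr carr)
  have "finite K1" using K1 K finite_subset by blast
  from primeideal_lowest_terms[OF C(2) ideals(2) _ a(3,4) this K1(2) _ K1(4)]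
  obtain K2 where K2: "K2 \<subseteq> K1" "K2 \<noteq> {}" "\<forall>e\<in>K2. \<forall>e'\<in>K2. e j = e' j"
    "(\<Sum>e\<in>K2. h e * a3 ^ e n) \<in> C2"
    using chain by (auto simp: poly_ring_mult_closed poly_ring_power_closed h_carr carr)
  have "finite K2" using K2 \<open>finite K1\<close> finite_subset by blast
  from primeideal_lowest_terms[OF C(3) ideals(3) _ a(5,6) this K2(2) _ K2(4)]
  obtain K3 where K3: "K3 \<subseteq> K2" "K3 \<noteq> {}" "\<forall>e\<in>K3. \<forall>e'\<in>K3. e n = e' n"
    "(\<Sum>e\<in>K3. h e) \<in> ?P"
    using chain by (auto simp: h_carr)
  have "finite K3" using K3 \<open>finite K2\<close> finite_subset by blast
  define E where "E = (\<lambda>e :: nat \<Rightarrow> nat. \<Sum>l\<in>S. Poly_Mapping.single l (e l))"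
  have finS: "finite S" by (simp add: S_def)
  have h_eq: "h e = Poly_Mapping.single (E e) (c e)" for e
    using finS by (simp add: h_def E_def prod_var_power mult_single)
  \<comment> \<open>On \<open>K3\<close> the exponents at \<open>i\<close>, \<open>j\<close> and
    \<open>n\<close> are constant, so distinct members differ at an index in \<open>S\<close>. Their
    monomials are distinct and cannot cancel.\<close>
  have inj: "inj_on E K3"
  proof (rule inj_onI)
    fix e e' assume e: "e \<in> K3" "e' \<in> K3" and eq: "E e = E e'"
    have "e l = e' l" if "l \<le> n" for l
    proof (cases "l \<in> S")
      case True
      then show ?thesis
        using arg_cong[OF eq, of "\<lambda>x. Poly_Mapping.lookup x l"] finS
        by (simp add: E_def lookup_sum_single)
    next
      case False
      then have "l = i \<or> l = j \<or> l = n" using that by (auto simp: S_def)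
      then show ?thesis
        using K1(3) K2(1,3) K3(1,3) e by blast
    qed
    moreover have "e \<in> {..n} \<rightarrow>\<^sub>E UNIV" "e' \<in> {..n} \<rightarrow>\<^sub>E UNIV"
      using e K(3) K1(1) K2(1) K3(1) by blast+
    ultimately show "e = e'" by (intro PiE_ext) auto
  qed
  obtain e0 where e0: "e0 \<in> K3" using K3(2) by blast
  have "Poly_Mapping.lookup (\<Sum>e\<in>K3. h e) (E e0) = (\<Sum>e\<in>K3. if e = e0 then c e else 0)"
    unfolding lookup_sum h_eq lookup_single
    by (rule sum.cong) (use inj e0 in \<open>auto simp: when_def inj_on_eq_iff\<close>)
  also have "\<dots> = c e0" using e0 \<open>finite K3\<close> by simp
  also have "\<dots> \<noteq> 0" using c e0 K1(1) K2(1) K3(1) by blast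
  finally have "E e0 \<in> Poly_Mapping.keys (\<Sum>e\<in>K3. h e)" by (simp add: in_keys_iff)
  moreover have "Poly_Mapping.lookup (E e0) i = 0" "Poly_Mapping.lookup (E e0) j = 0"
    using finS by (simp_all add: E_def lookup_sum_single) (simp_all add: S_def)
  ultimately show False using K3(4) by (auto simp: two_var_ideal_def)
qed

lemma prime_height_two_var_ideal:
  assumes "i < n" "j < n" "i \<noteq> j"
  shows "prime_height (poly_ring n) (two_var_ideal n i j) \<le> 2"
  unfolding prime_height_def
proof (rule Sup_least, clarify)
  fix k C
  assume prime: "\<forall>l\<le>k. primeideal (C l) (poly_ring n)" and chain: "\<forall>l<k. C l \<subset> C (Suc l)"
    and top: "C k = two_var_ideal n i j"
  have "k \<le> 2"
  proof (rule ccontr)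
    assume "\<not> k \<le> 2"
    \<comment> \<open>The top four members of a longer chain already form a forbidden one.\<close>
    then obtain l where k: "k = Suc (Suc (Suc l))"
      by (metis Suc_le_D not_less_eq_eq numeral_2_eq_2)
    have "C l \<subset> C (Suc l)" "C (Suc l) \<subset> C (Suc (Suc l))"
      "C (Suc (Suc l)) \<subset> two_var_ideal n i j"
      using chain unfolding top[symmetric] k by auto
    then show False
      using no_prime_chain_two_var_ideal[of "C l" n "C (Suc l)" "C (Suc (Suc l))" i j]
        prime assms by (simp add: k)
  qed
  then show "enat k \<le> 2" by (simp add: numeral_eq_enat)
qed

lemma monomial_in_two_var_ideal:
  assumes u: "u \<in> carrier_vec n" and k: "k < n" "k = i \<or> k = j" "u $ k \<noteq> 0"
  shows "monomial u \<in> two_var_ideal n i j"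
proof -
  have "monomial u = Poly_Mapping.single (\<Sum>l<n. Poly_Mapping.single l (u $ l)) 1"
    using u by (simp add: monomial_def prod_var_power)
  then have "Poly_Mapping.keys (monomial u) = {\<Sum>l<n. Poly_Mapping.single l (u $ l)}"
    by simp
  then show ?thesis
    using k monomial_in_poly_ring[OF u] by (auto simp: two_var_ideal_def lookup_sum_single)
qed

text \<open>With opposite signs at \<open>i\<close> and \<open>j\<close>, one of the two variables
  divides the first monomial and the other divides the second.\<close>

lemma binomial_in_two_var_ideal:
  assumes v: "v \<in> carrier_vec n" and ij: "i < n" "j < n" and "v $ i * v $ j < 0"
  shows "monomial (pos_part v) - monomial (neg_part v) \<in> two_var_ideal n i j"
proof -
  interpret P: ideal "two_var_ideal n i j" "poly_ring n" by (rule ideal_two_var_ideal)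
  have carr: "pos_part v \<in> carrier_vec n" "neg_part v \<in> carrier_vec n"
    using v by (simp_all add: pos_part_def neg_part_def)
  have "v $ i > 0 \<and> v $ j < 0 \<or> v $ i < 0 \<and> v $ j > 0"
    using assms(4) by (auto simp: mult_less_0_iff)
  then have mem: "monomial (pos_part v) \<in> two_var_ideal n i j"
    "monomial (neg_part v) \<in> two_var_ideal n i j"
    using monomial_in_two_var_ideal[OF carr(1), of i i j] monomial_in_two_var_ideal[OF carr(1), of j i j]
      monomial_in_two_var_ideal[OF carr(2), of i i j] monomial_in_two_var_ideal[OF carr(2), of j i j]
      v ij by (auto simp: pos_part_def neg_part_def)
  have "- 1 \<in> carrier (poly_ring n)"
    by (intro poly_ring_uminus_closed poly_ring_one_closed)
  then show ?thesis
    using additive_subgroup.a_closed[OF P.is_additive_subgroup mem(1) P.I_l_closed[OF mem(2), of "- 1"]]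
    by simp
qed

section \<open>Basis ideals of small height\<close>

text \<open>Supplies the nonzero entry that the sign change count needs.\<close>

lemma rat_lin_indpt_nonzero:
  assumes "rat_lin_indpt n B" "B \<subseteq> carrier_vec n"
  shows "0\<^sub>v n \<notin> B"
proof
  interpret V: vec_space "TYPE(rat)" n .
  assume "0\<^sub>v n \<in> B"
  then have "map_vec rat_of_int (0\<^sub>v n) \<in> map_vec rat_of_int ` B" by (rule imageI)
  moreover have "map_vec rat_of_int (0\<^sub>v n) = 0\<^sub>v n" by (intro eq_vecI) auto
  ultimately have "0\<^sub>v n \<in> map_vec rat_of_int ` B" by simp
  moreover have univ: "(UNIV :: rat set) \<noteq> {0}" by (auto simp: set_eq_iff intro: exI[of _ 1])
  moreover have "map_vec rat_of_int ` B \<subseteq> carrier_vec n" using assms(2) by auto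
  ultimately have "V.lin_dep (map_vec rat_of_int ` B)"
    using V.zero_nin_lin_indpt[of "map_vec rat_of_int ` B"] univ by auto
  then show False using assms(1) by (simp add: rat_lin_indpt_def)
qed

lemma common_alternating_position:
  fixes t :: "nat \<Rightarrow> int"
  assumes n: "n \<ge> 2 * (r\<^sup>2 - r + 1)" and m: "m = n - r" and r: "r \<ge> 1"
    and t: "strict_mono_on {..<n} t"
    and A: "A = mat m n (\<lambda>(i, j). t j ^ i)"
    and B: "independent_lattice_vectors A r B"
  shows "\<exists>k. Suc k < n \<and> (\<forall>v\<in>B. v $ k * v $ Suc k < 0)"
proof (rule ccontr)
  assume no: "\<not> ?thesis"
  have B': "B \<subseteq> mat_kernel A" "finite B" "card B = r" "rat_lin_indpt n B"
    using B A by (auto simp: independent_lattice_vectors_def)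
  have A_carr: "A \<in> carrier_mat m n" using A by simp
  have Bn: "B \<subseteq> carrier_vec n"
    using B'(1) A_carr by (auto simp: mat_kernel_def)
  define bad where "bad = (\<lambda>v :: int vec. {k. Suc k < n \<and> v $ k * v $ Suc k \<ge> 0})"
  \<comment> \<open>Ensures that the truncated difference \<open>n - 1 - (n - r)\<close> really is
    \<open>r - 1\<close>.\<close>
  have rn: "r \<le> n - 1"
  proof -
    have "r \<le> r\<^sup>2" by (simp add: power2_eq_square)
    show ?thesis
    proof (cases "r = 1")
      case False
      then have "2 * r \<le> r\<^sup>2" using r by (simp add: power2_eq_square)
      then have "r \<le> r\<^sup>2 - r" by linarith
      then have "2 * (r + 1) \<le> 2 * (r\<^sup>2 - r + 1)" by (intro mult_left_mono) auto
      then have "2 * (r + 1) \<le> n" using n by (rule order_trans)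
      then show ?thesis by arith
    qed (use n in simp)
  qed
  have card_bad: "card (bad v) \<le> 2 * (r - 1)" if v: "v \<in> B" for v
  proof -
    have vn: "v \<in> carrier_vec n" using Bn v by blast
    have "A *\<^sub>v v = 0\<^sub>v m" using B'(1) v A_carr by (auto simp: mat_kernel_def)
    then have "(\<Sum>k<n. v $ k * t k ^ i) = 0" if i: "i < m" for i
    proof -
      have "(A *\<^sub>v v) $ i = 0" using \<open>A *\<^sub>v v = 0\<^sub>v m\<close> i by simp
      moreover have "(A *\<^sub>v v) $ i = (\<Sum>k<n. v $ k * t k ^ i)"
        using i vn by (auto simp: A scalar_prod_def mult.commute lessThan_atLeast0 intro!: sum.cong)
      ultimately show ?thesis by simp
    qed
    moreover have "\<exists>k<n. v $ k \<noteq> 0"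
    proof (rule ccontr)
      assume "\<not> (\<exists>k<n. v $ k \<noteq> 0)"
      then have "v = 0\<^sub>v n" using vn by (intro eq_vecI) auto
      then show False using rat_lin_indpt_nonzero[OF B'(4) Bn] v by simp
    qed
    ultimately have "card (bad v) \<le> 2 * (n - 1 - m)"
      unfolding bad_def by (intro card_nonalternating_le[OF t]) auto
    also have "n - 1 - m = r - 1" using m rn r by linarith
    finally show ?thesis .
  qed
  \<comment> \<open>Without a common alternating position, the bad sets of the \<open>r\<close>
    vectors cover all \<open>n - 1\<close> neighbouring pairs, but together they have at most
    \<open>2 * (r\<^sup>2 - r)\<close> elements, while the bound on \<open>n\<close> gives
    \<open>n - 1 \<ge> 2 * (r\<^sup>2 - r) + 1\<close>.\<close>
  have "{..<n - 1} \<subseteq> (\<Union>v\<in>B. bad v)"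
    using no by (force simp: bad_def not_less)
  moreover have "finite (\<Union>v\<in>B. bad v)"
    using B'(2) by (auto simp: bad_def intro: finite_subset[of _ "{..<n}"])
  ultimately have "n - 1 \<le> card (\<Union>v\<in>B. bad v)"
    by (metis card_lessThan card_mono)
  also have "\<dots> \<le> (\<Sum>v\<in>B. card (bad v))"
    by (rule card_UN_le[OF B'(2)])
  also have "\<dots> \<le> (\<Sum>v\<in>B. 2 * (r - 1))"
    by (rule sum_mono) (rule card_bad)
  also have "\<dots> = 2 * (r\<^sup>2 - r)"
    using B'(3) by (simp add: power2_eq_square diff_mult_distrib2)
  finally show False using n by arith
qed

theorem theorem4p1:
  fixes r n m :: nat and t :: "nat \<Rightarrow> int" and A :: "int mat"
  assumes "r \<ge> 3"
    and "n \<ge> 2 * (r\<^sup>2 - r + 1)"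
    and "m = n - r"
    and "0 < t 0"
    and "strict_mono_on {..<n} t"
    and "A = mat m n (\<lambda>(i, j). t j ^ i)"
  shows "\<not> (\<exists>B. independent_lattice_vectors A r B \<and>
               complete_intersection n r (basis_ideal n B) \<and>
               basis_ideal n B \<subseteq> toric_ideal A) \<and>
         (\<forall>B. independent_lattice_vectors A r B \<longrightarrow>
               \<not> complete_intersection n r (basis_ideal n B))"
proof -
  have "\<not> complete_intersection n r (basis_ideal n B)" if B: "independent_lattice_vectors A r B" for B
  proof
    interpret R: cring "poly_ring n" by (rule poly_ring_cring)
    assume ci: "complete_intersection n r (basis_ideal n B)"
    obtain k where k: "Suc k < n" and alt: "\<And>v. v \<in> B \<Longrightarrow> v $ k * v $ Suc k < 0"
      using common_alternating_position[OF assms(2,3) _ assms(5,6) B] assms(1) by auto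
    let ?P = "two_var_ideal n k (Suc k)"
    have Bn: "B \<subseteq> carrier_vec n"
      using B assms(6) by (auto simp: independent_lattice_vectors_def mat_kernel_def)
    have "basis_ideal n B \<subseteq> ?P"
      unfolding basis_ideal_def
      using binomial_in_two_var_ideal[of _ n k "Suc k"] alt k Bn
      by (intro R.genideal_minimal ideal_two_var_ideal) auto
    \<comment> \<open>The height of the basis ideal is an infimum over primes containing it, so the
      single prime \<open>?P\<close> bounds it by \<open>2\<close>, which is less than
      \<open>r\<close>.\<close>
    then have "ideal_height (poly_ring n) (basis_ideal n B) \<le> prime_height (poly_ring n) ?P"
      unfolding ideal_height_def using primeideal_two_var_ideal by (intro Inf_lower) blast
    also have "\<dots> \<le> 2"
      using k by (intro prime_height_two_var_ideal) auto
    finally show False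
      using ci assms(1) by (simp add: complete_intersection_def numeral_eq_enat)
  qed
  then show ?thesis by blast
qed

end
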